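(* Let $S^n=\{u\in\mathbb R^{n+1}: u_i\ge 0 \text{ for all } i,\ \sum_{i=1}^{n+1}u_i=1\}$ be the $n$-dimensional simplex. Then $$\lim_{n\to\infty}\frac{w_2(S^n)}{\log_2 n}=\frac14 .$$
   Context: For a nonempty closed bounded set $K\subset\mathbb R^N$, $C(K)$ is the space of continuous real-valued functions on $K$. For $f\in C(K)$, let $E_2(f;K)=\inf_{\varphi}\max_{x\in K}|f(x)-\varphi(x)|$, the infimum over all real polynomials $\varphi$ on $\mathbb R^N$ of degree at most $1$ (affine functions); let $\omega_2(f;K)=\sup|f(x)-2f(x+h)+f(x+2h)|$, the supremum over all $x,h\in\mathbb R^N$ with $x,x+h,x+2h\in K$. The Whitney constant is $w_2(K)=\sup\{E_2(f;K): f\in C(K),\ \omega_2(f;K)\le 1\}$. *)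

theory Defs
  imports "HOL-Analysis.Analysis"
begin

text \<open>
  The dimension varies inside the limit, so \<open>\<real>\<^sup>N\<close> is rendered by the library topology
  \<^const>\<open>Euclidean_space\<close>: its points are the \<^typ>\<open>nat \<Rightarrow> real\<close> vanishing at all
  indices \<open>\<ge> N\<close>, so the coordinates are numbered \<open>0, \<dots>, N - 1\<close>. Suprema and infima are
  taken in \<^typ>\<open>ereal\<close>, so that none of them needs a boundedness side condition.
\<close>

definition C_space :: "nat \<Rightarrow> (nat \<Rightarrow> real) set \<Rightarrow> ((nat \<Rightarrow> real) \<Rightarrow> real) set" where
  "C_space N K = {f. continuous_map (subtopology (Euclidean_space N) K) euclideanreal f}"

definition affine_funs :: "nat \<Rightarrow> ((nat \<Rightarrow> real) \<Rightarrow> real) set" where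
  "affine_funs N = {\<phi>. \<exists>c a. \<phi> = (\<lambda>x. c + (\<Sum>i<N. a i * x i))}"

definition E2 :: "nat \<Rightarrow> ((nat \<Rightarrow> real) \<Rightarrow> real) \<Rightarrow> (nat \<Rightarrow> real) set \<Rightarrow> ereal" where
  "E2 N f K = (INF \<phi>\<in>affine_funs N. SUP x\<in>K. ereal \<bar>f x - \<phi> x\<bar>)"

definition omega2 :: "nat \<Rightarrow> ((nat \<Rightarrow> real) \<Rightarrow> real) \<Rightarrow> (nat \<Rightarrow> real) set \<Rightarrow> ereal" where
  "omega2 N f K =
     Sup {ereal \<bar>f x - 2 * f (\<lambda>i. x i + h i) + f (\<lambda>i. x i + 2 * h i)\<bar> | x h.
            x \<in> topspace (Euclidean_space N) \<and> h \<in> topspace (Euclidean_space N) \<and>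
            x \<in> K \<and> (\<lambda>i. x i + h i) \<in> K \<and> (\<lambda>i. x i + 2 * h i) \<in> K}"

definition w2 :: "nat \<Rightarrow> (nat \<Rightarrow> real) set \<Rightarrow> ereal" where
  "w2 N K = Sup {E2 N f K | f. f \<in> C_space N K \<and> omega2 N f K \<le> 1}"

definition simplex_S :: "nat \<Rightarrow> (nat \<Rightarrow> real) set" where
  "simplex_S n = {u \<in> topspace (Euclidean_space (n + 1)).
                    (\<forall>i<n + 1. 0 \<le> u i) \<and> (\<Sum>i<n + 1. u i) = 1}"

end

theory Submission
  imports Defs
begin

text \<open>
  Write \<open>N = n + 1\<close>. The lower bound comes from half of the Shannon entropy (in bits),
  \<open>f u = - (\<Sum>i. u i * log 2 (u i)) / 2\<close>. The entropy of a midpoint exceeds the mean of the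
  entropies by at least 0 and at most 1 bit, so \<open>f\<close> has second differences at most 1; since \<open>f\<close>
  vanishes at the vertices and equals \<open>log 2 N / 2\<close> at the barycentre, no affine function is closer to \<open>f\<close>
  than \<open>log 2 N / 4\<close>.

  For the upper bound \<open>log 2 N / 4 + O(log (log N))\<close>, let \<open>g = f - \<phi>\<close> with \<open>\<phi>\<close> an almost optimal
  affine function and \<open>M\<close> a bound of \<open>\<bar>g\<bar>\<close> that is almost attained. If the set \<open>X\<close> of points with
  \<open>g \<ge> M - 1\<close> and the set \<open>Y\<close> of points with \<open>g \<le> 1 - M\<close> had convex hulls at a distance above
  a threshold depending only on \<open>N\<close>, an affine function separating them would improve \<open>\<phi>\<close>
  (\<open>separation\<close> and \<open>affine_approximation_improvable\<close>). So some convex combination of points of \<open>X\<close> nearly equals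
  one of points of \<open>Y\<close>.

  The heart of the matter is that \<open>g\<close> cannot drop much on pieces of a near-maximum point \<open>x\<close>. If
  \<open>2 ^ r\<close> points \<open>z\<close> of the simplex have \<open>g z \<le> M - r / 2 - 9\<close>, then repeated halving shows that
  their average has \<open>g \<le> M - 9\<close>, and such a point cannot make up a quarter of \<open>x\<close>. Hence pieces
  of this kind, \<open>z\<close> being given the weight \<open>1 / 2 ^ (r + 2)\<close>, cannot fill a quarter of \<open>x\<close>, and
  after the removal of a maximal packing three quarters of the mass of \<open>x\<close> remain as a core \<open>p\<close>
  below which no bad piece fits (\<open>core_exists\<close>). Every point \<open>y\<close> of \<open>Y\<close> has such a core \<open>q\<close> for
  \<open>- g\<close>. Averaging over the two nearly equal convex combinations and using the Cauchy-Schwarz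
  inequality gives a pair with \<open>(\<Sum>i. p i * q i) \<ge> 1 / (8 * N)\<close> (\<open>overlapping_truncations\<close>).

  Up to a factor \<open>O((log N)\<^sup>2)\<close>, this overlap is concentrated on a set \<open>Q\<close> of indices on which
  \<open>p \<approx> 1 / 2 ^ a\<close> and \<open>q \<approx> 1 / 2 ^ b\<close>. With \<open>card Q \<approx> 2 ^ s\<close>, the uniform distribution \<open>z\<close> on
  \<open>Q\<close> fits into \<open>p\<close> at level about \<open>a - s\<close> and into \<open>q\<close> at level about \<open>b - s\<close>, so
  \<open>M - (a - s) / 2 - O(1) \<le> g z \<le> - M + (b - s) / 2 + O(1)\<close>. The size of the overlap says
  \<open>a + b - s \<le> log 2 N + O(log (log N))\<close>, and therefore
  \<open>4 * M \<le> log 2 N + O(log (log N))\<close> (\<open>overlapping_cores\<close>).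
\<close>

section \<open>The simplex\<close>

lemma simplex_S_iff:
  "u \<in> simplex_S n \<longleftrightarrow> (\<forall>i. 0 \<le> u i) \<and> (\<forall>i>n. u i = 0) \<and> (\<Sum>i\<le>n. u i) = 1"
  unfolding simplex_S_def topspace_Euclidean_space
  by (auto simp: lessThan_Suc_atMost less_Suc_eq_le Suc_le_eq) (metis le_less_linear order_refl)

lemma simplex_S_mix:
  assumes "x \<in> simplex_S n" "y \<in> simplex_S n" "0 \<le> s" "0 \<le> t" "s + t = 1"
  shows "(\<lambda>i. s * x i + t * y i) \<in> simplex_S n"
  using assms by (auto simp: simplex_S_iff sum.distrib simp flip: sum_distrib_left)

lemma simplex_S_midpoint:
  assumes "x \<in> simplex_S n" "y \<in> simplex_S n"
  shows "(\<lambda>i. (x i + y i) / 2) \<in> simplex_S n"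
  using simplex_S_mix[OF assms, of "1/2" "1/2"] by (simp add: add_divide_distrib)

lemma simplex_S_le_1:
  assumes "x \<in> simplex_S n" shows "x i \<le> 1"
proof (cases "i \<le> n")
  case True
  then have "x i \<le> (\<Sum>i\<le>n. x i)" using assms
    by (intro member_le_sum) (auto simp: simplex_S_iff)
  then show ?thesis using assms by (simp add: simplex_S_iff)
qed (use assms in \<open>simp add: simplex_S_iff\<close>)

section \<open>Approximately midpoint-convex functions\<close>

text \<open>
  For \<open>\<omega>\<^sub>2 \<le> 1\<close> the value at a midpoint differs from the mean of the values by at most one half.
  This is the upper half of that condition; the lower half is the same statement about \<open>- g\<close>.
\<close>

definition approx_convex :: "nat \<Rightarrow> ((nat \<Rightarrow> real) \<Rightarrow> real) \<Rightarrow> bool" where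
  "approx_convex n g \<longleftrightarrow> (\<forall>x\<in>simplex_S n. \<forall>y\<in>simplex_S n.
     g (\<lambda>i. (x i + y i) / 2) \<le> (g x + g y) / 2 + 1 / 2)"

lemma approx_convexD:
  assumes "approx_convex n g" "x \<in> simplex_S n" "y \<in> simplex_S n"
  shows "g (\<lambda>i. (x i + y i) / 2) \<le> (g x + g y) / 2 + 1 / 2"
  using assms by (simp add: approx_convex_def)

text \<open>
  If \<open>s \<le> 1 / 2\<close>, the point \<open>s x + t y\<close> is the midpoint of \<open>y\<close> and \<open>2 s x + (1 - 2 s) y\<close>.
  So a bound \<open>c\<close> on the excess over the chord improves to \<open>1 / 2 + c / 2\<close>, and iterating from the
  crude bound \<open>2 * M\<close> drives it down to the fixed point 1.
\<close>

lemma approx_convex_segment: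
  assumes g: "approx_convex n g" and bdd: "\<And>z. z \<in> simplex_S n \<Longrightarrow> \<bar>g z\<bar> \<le> M"
    and x: "x \<in> simplex_S n" and y: "y \<in> simplex_S n" and s: "0 \<le> s" and t: "0 \<le> t"
    and st: "s + t = 1"
  shows "g (\<lambda>i. s * x i + t * y i) \<le> s * g x + t * g y + 1"
proof -
  have *: "g (\<lambda>i. s * x i + t * y i) \<le> s * g x + t * g y + 1 + 2 * M / 2 ^ k"
    if "x \<in> simplex_S n" "y \<in> simplex_S n" "0 \<le> s" "0 \<le> t" "s + t = 1" for k x y s t
    using that
  proof (induction k arbitrary: x y s t)
    case 0
    have "- M \<le> g x" "- M \<le> g y" using 0 bdd[of x] bdd[of y] by auto
    then have "s * - M \<le> s * g x" "t * - M \<le> t * g y"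
      using 0 by (simp_all only: mult_left_mono)
    moreover have "s * - M + t * - M = - M"
      using \<open>s + t = 1\<close> by (metis distrib_right mult_1)
    ultimately have "s * g x + t * g y \<ge> - M" by linarith
    then show ?case using bdd[OF simplex_S_mix[OF 0]] by simp
  next
    case (Suc k)
    have half: "g (\<lambda>i. s * x i + t * y i) \<le> s * g x + t * g y + 1 + 2 * M / 2 ^ Suc k"
      if prems: "x \<in> simplex_S n" "y \<in> simplex_S n" "0 \<le> s" "0 \<le> t" "s + t = 1" and "s \<le> 1/2"
      for x y s t
    proof -
      let ?w = "\<lambda>i. (2 * s) * x i + (1 - 2 * s) * y i"
      have w: "?w \<in> simplex_S n"
        using prems \<open>s \<le> 1/2\<close> by (intro simplex_S_mix) auto
      have eq: "(\<lambda>i. s * x i + t * y i) = (\<lambda>i. (?w i + y i) / 2)"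
      proof -
        have t: "t = 1 - s" using prems by simp
        show ?thesis unfolding t by (auto simp: field_simps)
      qed
      have t: "t = 1 - s" using prems by simp
      have "g ?w \<le> (2 * s) * g x + (1 - 2 * s) * g y + 1 + 2 * M / 2 ^ k"
        using prems \<open>s \<le> 1/2\<close> by (intro Suc.IH) auto
      then have "(g ?w + g y) / 2 + 1 / 2 \<le>
          ((2 * s) * g x + (1 - 2 * s) * g y + 1 + 2 * M / 2 ^ k + g y) / 2 + 1 / 2" by simp
      also have "\<dots> = s * g x + t * g y + 1 + 2 * M / 2 ^ Suc k"
        unfolding t by (simp add: field_simps)
      finally show ?thesis
        unfolding eq using approx_convexD[OF g w prems(2)] by linarith
    qed
    show ?case
    proof (cases "s \<le> 1/2")
      case True
      then show ?thesis using half Suc.prems by blast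
    next
      case False
      then show ?thesis using half[of y x t s] Suc.prems by (simp add: add.commute)
    qed
  qed
  have "(\<lambda>k. s * g x + t * g y + 1 + 2 * M / 2 ^ k) \<longlonglongrightarrow> s * g x + t * g y + 1 + 0"
    by (intro tendsto_intros) real_asymp
  then show ?thesis
    using *[OF x y s t st] by (intro LIMSEQ_le_const[where X = "\<lambda>k. s * g x + t * g y + 1 + 2 * M / 2 ^ k"]) auto
qed

section \<open>Packing a near-maximum point with bad pieces\<close>

text \<open>
  The weight of a piece halves when its level grows by one, and at the same time the value of \<open>g\<close>
  has to be lower by a further one half. Both rates are dictated by the merging of two pieces of equal
  level below. The constants 9 and 2 make a piece of level 0 weigh a quarter and have a value that
  contradicts near-maximality.
\<close>

definition bad_pieces :: "nat \<Rightarrow> ((nat \<Rightarrow> real) \<Rightarrow> real) \<Rightarrow> real \<Rightarrow> nat \<Rightarrow> (nat \<Rightarrow> real) set" where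
  "bad_pieces n g M r = {\<lambda>i. z i / 2 ^ (r + 2) | z. z \<in> simplex_S n \<and> g z \<le> M - r / 2 - 9}"

lemma bad_pieces_merge:
  assumes g: "approx_convex n g"
    and "u \<in> bad_pieces n g M (Suc r)" "v \<in> bad_pieces n g M (Suc r)"
  shows "(\<lambda>i. u i + v i) \<in> bad_pieces n g M r"
proof -
  obtain y z where y: "y \<in> simplex_S n" "g y \<le> M - Suc r / 2 - 9" "u = (\<lambda>i. y i / 2 ^ (Suc r + 2))"
    and z: "z \<in> simplex_S n" "g z \<le> M - Suc r / 2 - 9" "v = (\<lambda>i. z i / 2 ^ (Suc r + 2))"
    using assms unfolding bad_pieces_def by blast
  let ?w = "\<lambda>i. (y i + z i) / 2"
  have "g ?w \<le> (g y + g z) / 2 + 1 / 2"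
    by (rule approx_convexD[OF g y(1) z(1)])
  then have "g ?w \<le> M - r / 2 - 9" using y z by (simp add: field_simps)
  moreover have "(\<lambda>i. u i + v i) = (\<lambda>i. ?w i / 2 ^ (r + 2))"
    using y z by (auto simp: field_simps)
  ultimately show ?thesis
    using simplex_S_midpoint[OF y(1) z(1)] unfolding bad_pieces_def
    by (intro CollectI exI[of _ ?w] conjI)
qed

lemma bad_pieces_nonneg: "u \<in> bad_pieces n g M r \<Longrightarrow> 0 \<le> u i"
  by (auto simp: bad_pieces_def simplex_S_iff)

lemma bad_pieces_mass: "u \<in> bad_pieces n g M r \<Longrightarrow> (\<Sum>i\<le>n. u i) = 1 / 2 ^ (r + 2)"
  by (auto simp: bad_pieces_def simplex_S_iff simp flip: sum_divide_distrib)

text \<open>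
  A packing uses every positive level at most once, like the digits of a binary number: two pieces
  of equal level are merged into one of the level below, which plays the role of the carry. Its mass is
  therefore less than a quarter.
\<close>

fun packings :: "nat \<Rightarrow> ((nat \<Rightarrow> real) \<Rightarrow> real) \<Rightarrow> real \<Rightarrow> nat \<Rightarrow> (nat \<Rightarrow> real) set" where
  "packings n g M 0 = {\<lambda>_. 0}"
| "packings n g M (Suc R) =
     {\<lambda>i. p i + u i | p u. p \<in> packings n g M R \<and> u \<in> insert (\<lambda>_. 0) (bad_pieces n g M (Suc R))}"

lemma packings_SucI:
  assumes "p \<in> packings n g M R" "u = (\<lambda>_. 0) \<or> u \<in> bad_pieces n g M (Suc R)"
    "q = (\<lambda>i. p i + u i)"
  shows "q \<in> packings n g M (Suc R)"
  using assms by auto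

lemma packings_SucE:
  assumes "q \<in> packings n g M (Suc R)"
  obtains p u where "p \<in> packings n g M R" "u = (\<lambda>_. 0) \<or> u \<in> bad_pieces n g M (Suc R)"
    "q = (\<lambda>i. p i + u i)"
  using assms by auto

lemma packings_nonneg: "p \<in> packings n g M R \<Longrightarrow> 0 \<le> p i"
proof (induction R arbitrary: p)
  case (Suc R)
  then show ?case
    by (elim packings_SucE) (auto simp: bad_pieces_nonneg)
qed auto

lemma packings_zero: "(\<lambda>_. 0) \<in> packings n g M R"
proof (induction R)
  case (Suc R)
  then show ?case by (intro packings_SucI[OF Suc, of "\<lambda>_. 0"]) auto
qed auto

lemma packings_mass: "p \<in> packings n g M R \<Longrightarrow> (\<Sum>i\<le>n. p i) \<le> 1 / 4 - 1 / 2 ^ (R + 2)"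
proof (induction R arbitrary: p)
  case (Suc R)
  from Suc.prems obtain q u where q: "q \<in> packings n g M R"
    and u: "u = (\<lambda>_. 0) \<or> u \<in> bad_pieces n g M (Suc R)" and p: "p = (\<lambda>i. q i + u i)"
    by (elim packings_SucE)
  have "(\<Sum>i\<le>n. u i) \<le> 1 / 2 ^ (Suc R + 2)"
    using u bad_pieces_mass[of u n g M "Suc R"] by auto
  then show ?case using Suc.IH[OF q] by (simp add: p sum.distrib field_simps)
qed auto

text \<open>
  This is binary addition of one digit. The carry either comes to rest at some positive level or runs
  through to a piece of level 0.
\<close>

lemma packings_add:
  assumes g: "approx_convex n g"
    and "p \<in> packings n g M R" "u \<in> bad_pieces n g M r" "1 \<le> r" "r \<le> R"
  shows "(\<exists>v\<in>bad_pieces n g M 0. \<forall>i. v i \<le> p i + u i) \<or> (\<lambda>i. p i + u i) \<in> packings n g M R"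
  using assms(2-)
proof (induction R arbitrary: p u r)
  case (Suc R)
  from Suc.prems(1) obtain q v where q: "q \<in> packings n g M R"
    and v: "v = (\<lambda>_. 0) \<or> v \<in> bad_pieces n g M (Suc R)" and p: "p = (\<lambda>i. q i + v i)"
    by (elim packings_SucE)
  have v0: "0 \<le> v i" for i using v bad_pieces_nonneg by auto
  show ?case
  proof (cases "r = Suc R")
    case False
    then have "r \<le> R" using Suc.prems by simp
    from Suc.IH[OF q Suc.prems(2,3) this] show ?thesis
    proof (elim disjE bexE)
      fix w assume "w \<in> bad_pieces n g M 0" "\<forall>i. w i \<le> q i + u i"
      then show ?thesis unfolding p
        by (intro disjI1 bexI[of _ w]) (auto intro: order_trans[OF _ add_right_mono] simp: v0)
    next
      assume "(\<lambda>i. q i + u i) \<in> packings n g M R"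
      from packings_SucI[OF this v] show ?thesis
        unfolding p by (simp add: add_ac)
    qed
  next
    case True
    then have u: "u \<in> bad_pieces n g M (Suc R)" using Suc.prems by simp
    from v show ?thesis
    proof
      assume "v = (\<lambda>_. 0)"
      then show ?thesis using packings_SucI[OF q disjI2[OF u]] by (simp add: p)
    next
      assume "v \<in> bad_pieces n g M (Suc R)"
      from bad_pieces_merge[OF g this u] have vu: "(\<lambda>i. v i + u i) \<in> bad_pieces n g M R" .
      show ?thesis
      proof (cases "R = 0")
        case True
        then show ?thesis using vu packings_nonneg[OF q]
          by (intro disjI1 bexI[of _ "\<lambda>i. v i + u i"]) (auto simp: p)
      next
        case False
        with Suc.IH[OF q vu] have "(\<exists>w\<in>bad_pieces n g M 0. \<forall>i. w i \<le> q i + (v i + u i)) \<or>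
            (\<lambda>i. q i + (v i + u i)) \<in> packings n g M R" by simp
        then show ?thesis
        proof
          assume "(\<lambda>i. q i + (v i + u i)) \<in> packings n g M R"
          from packings_SucI[OF this, of "\<lambda>_. 0"] show ?thesis by (simp add: p add_ac)
        qed (auto simp: p add_ac)
      qed
    qed
  qed
qed simp

text \<open>
  A piece of level 0 below \<open>x\<close> is a quarter of \<open>x\<close> on which \<open>g \<le> M - 9\<close>. The remaining three quarters
  cannot make up for it: \<open>g x \<le> (M - 9) / 4 + 3 * M / 4 + 1 < M - 1\<close>.
\<close>

lemma no_heavy_bad_piece:
  assumes g: "approx_convex n g" and bdd: "\<And>z. z \<in> simplex_S n \<Longrightarrow> \<bar>g z\<bar> \<le> M"
    and x: "x \<in> simplex_S n" and gx: "M - 1 \<le> g x" and v: "v \<in> bad_pieces n g M 0"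
  shows "\<not> (\<forall>i. v i \<le> x i)"
proof
  assume le: "\<forall>i. v i \<le> x i"
  obtain z where z: "z \<in> simplex_S n" "g z \<le> M - 9" "v = (\<lambda>i. z i / 4)"
    using v by (auto simp: bad_pieces_def)
  define w where "w = (\<lambda>i. (x i - z i / 4) * (4 / 3))"
  have w: "w \<in> simplex_S n"
    using x z le unfolding simplex_S_iff w_def
    by (auto simp: sum_subtractf simp flip: sum_distrib_right sum_divide_distrib)
  have "x = (\<lambda>i. 1/4 * z i + 3/4 * w i)" by (auto simp: w_def field_simps)
  then have "g x \<le> 1/4 * g z + 3/4 * g w + 1"
    using approx_convex_segment[OF g bdd z(1) w, of "1/4" "3/4"] by simp
  then show False using z(2) gx bdd[OF w] by simp
qed

section \<open>Cores of near-maximum points\<close>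

text \<open>
  The condition says that no bad piece of level at most \<open>R\<close> fits below \<open>p\<close>; the core of a point is a
  subvector of it with this property.
\<close>

definition core :: "nat \<Rightarrow> ((nat \<Rightarrow> real) \<Rightarrow> real) \<Rightarrow> real \<Rightarrow> nat \<Rightarrow> (nat \<Rightarrow> real) \<Rightarrow> bool" where
  "core n g M R p \<longleftrightarrow> (\<forall>r\<le>R. \<forall>z\<in>simplex_S n. (\<forall>i. z i / 2 ^ (r + 2) \<le> p i) \<longrightarrow> M - r / 2 - 9 < g z)"

lemma coreD:
  assumes "core n g M R p" "r \<le> R" "z \<in> simplex_S n" "\<And>i. z i / 2 ^ (r + 2) \<le> p i"
  shows "M - real r / 2 - 9 < g z"
  using assms unfolding core_def by blast

text \<open>
  The core is what a packing of almost maximal mass leaves of \<open>x\<close>. A bad piece that still fits could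
  be added to the packing, which would either increase the mass by at least \<open>1 / 2 ^ (R + 2)\<close> or produce
  a piece of level 0 below \<open>x\<close>.
\<close>

lemma core_exists:
  assumes g: "approx_convex n g" and bdd: "\<And>z. z \<in> simplex_S n \<Longrightarrow> \<bar>g z\<bar> \<le> M"
    and x: "x \<in> simplex_S n" and gx: "M - 1 \<le> g x"
  shows "\<exists>p. (\<forall>i. 0 \<le> p i \<and> p i \<le> x i) \<and> 3 / 4 \<le> (\<Sum>i\<le>n. p i) \<and> core n g M R p"
proof -
  define P where "P = {q \<in> packings n g M R. \<forall>i. q i \<le> x i}"
  let ?m = "\<lambda>q. \<Sum>i\<le>n. q i"
  have ne: "?m ` P \<noteq> {}" using packings_zero[of n g M R] x by (force simp: P_def simplex_S_iff)
  have bd: "bdd_above (?m ` P)"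
    using packings_mass by (intro bdd_aboveI[of _ "1/4 - 1 / 2 ^ (R + 2)"]) (auto simp: P_def)
  have "Sup (?m ` P) - 1 / 2 ^ (R + 2) < Sup (?m ` P)" by simp
  then obtain q where q: "q \<in> P" and big: "Sup (?m ` P) - 1 / 2 ^ (R + 2) < ?m q"
    using less_cSup_iff[OF ne bd] by auto
  have core: "M - r / 2 - 9 < g z" if r: "r \<le> R" and z: "z \<in> simplex_S n"
    and le: "\<And>i. z i / 2 ^ (r + 2) \<le> x i - q i" for r z
  proof (rule ccontr)
    define u where "u = (\<lambda>i. z i / 2 ^ (r + 2))"
    assume "\<not> ?thesis"
    then have u: "u \<in> bad_pieces n g M r" using z unfolding bad_pieces_def u_def by auto
    have fits: "\<forall>i. q i + u i \<le> x i" using le by (auto simp: u_def algebra_simps)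
    have q': "q \<in> packings n g M R" using q by (simp add: P_def)
    show False
    proof (cases "r = 0")
      case True
      have "\<forall>i. u i \<le> x i"
        using fits packings_nonneg[OF q'] by (meson add_increasing order_refl order_trans)
      then show False using no_heavy_bad_piece[OF g bdd x gx] u True by blast
    next
      case False
      then have "1 \<le> r" by simp
      from packings_add[OF g q' u this r] show False
      proof
        assume "\<exists>v\<in>bad_pieces n g M 0. \<forall>i. v i \<le> q i + u i"
        then show False using no_heavy_bad_piece[OF g bdd x gx] fits by (meson order_trans)
      next
        assume "(\<lambda>i. q i + u i) \<in> packings n g M R"
        then have "?m (\<lambda>i. q i + u i) \<le> Sup (?m ` P)"
          using fits by (intro cSup_upper[OF _ bd] imageI) (auto simp: P_def)
        then have "?m q + 1 / 2 ^ (r + 2) \<le> Sup (?m ` P)"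
          using bad_pieces_mass[OF u] by (simp add: sum.distrib)
        moreover have "1 / 2 ^ (R + 2) \<le> (1 / 2 ^ (r + 2) :: real)"
          using r by (intro divide_left_mono) auto
        ultimately show False using big by simp
      qed
    qed
  qed
  have "?m q \<le> 1 / 4 - 1 / 2 ^ (R + 2)" using q packings_mass unfolding P_def by blast
  also have "\<dots> \<le> 1 / 4" by simp
  finally have "?m q \<le> 1 / 4" .
  then have "3 / 4 \<le> ?m (\<lambda>i. x i - q i)" using x by (simp add: sum_subtractf simplex_S_iff)
  then show ?thesis using q core packings_nonneg[of q n g M R]
    by (intro exI[of _ "\<lambda>i. x i - q i"]) (auto simp: P_def core_def)
qed

lemma dyadic_scale:
  fixes t :: real
  assumes "0 < t" "t \<le> 1"
  shows "\<exists>a. 1 / 2 ^ (a + 1) < t \<and> t \<le> 1 / 2 ^ a"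
proof -
  obtain k where k: "(1 / 2) ^ k < t" using real_arch_pow_inv[of t "1 / 2"] assms by auto
  have "(1 / 2 :: real) ^ (k + 1) \<le> (1 / 2) ^ k" by simp
  then have ex: "1 / 2 ^ (k + 1) < t" using k by (simp add: power_divide)
  define a where "a = (LEAST a. 1 / 2 ^ (a + 1) < t)"
  have a: "1 / 2 ^ (a + 1) < t" unfolding a_def using ex by (rule LeastI)
  have "t \<le> 1 / 2 ^ a"
  proof (cases a)
    case (Suc b)
    then have "\<not> 1 / 2 ^ (b + 1) < t" 
      using not_less_Least[of b "\<lambda>a. 1 / 2 ^ (a + 1) < t"] unfolding a_def[symmetric] by simp
    then show ?thesis using Suc by simp
  qed (use assms in simp)
  with a show ?thesis by blast
qed

text \<open>
  One point \<open>z\<close> is tested against both cores, where it yields a lower and an upper bound for \<open>g z\<close>.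
  The best choice is uniform on a set of indices on which \<open>p\<close> and \<open>q\<close> are both constant up to a factor
  2. There are at most \<open>(L + 1)\<^sup>2\<close> pairs of dyadic scales to consider, because the indices where \<open>p\<close>
  or \<open>q\<close> is below \<open>1 / (32 * N)\<close> carry at most half of the overlap.
\<close>

lemma overlapping_cores:
  fixes p q :: "nat \<Rightarrow> real"
  assumes p: "\<And>i. 0 \<le> p i" "(\<Sum>i\<le>n. p i) \<le> 1" and q: "\<And>i. 0 \<le> q i" "(\<Sum>i\<le>n. q i) \<le> 1"
    and L: "32 * (real n + 1) \<le> 2 ^ L"
    and overlap: "1 / (8 * (real n + 1)) \<le> (\<Sum>i\<le>n. p i * q i)"
    and cp: "core n g M (L + 1) p" and cq: "core n (\<lambda>x. - g x) M (L + 1) q"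
  shows "4 * M \<le> 38 + log 2 (32 * (real n + 1) * (real L + 1)\<^sup>2)"
proof -
  define N where "N = real n + 1"
  have N: "1 \<le> N" by (simp add: N_def)
  define I where "I = {i. i \<le> n \<and> 1 / (32 * N) \<le> p i \<and> 1 / (32 * N) \<le> q i}"
  have finI: "finite I" by (rule finite_subset[of _ "{..n}"]) (auto simp: I_def)
  have p1: "p i \<le> 1" if "i \<le> n" for i
    using member_le_sum[of i "{..n}" p] p that by simp
  have q1: "q i \<le> 1" if "i \<le> n" for i
    using member_le_sum[of i "{..n}" q] q that by simp
  have "1 / (8 * N) \<le> (\<Sum>i\<le>n. p i * q i)" using overlap by (simp add: N_def)
  also have "\<dots> \<le> (\<Sum>i\<le>n. (if i \<in> I then p i * q i else 0) + q i / (32 * N) + p i / (32 * N))"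
  proof (rule sum_mono)
    fix i assume i: "i \<in> {..n}"
    show "p i * q i \<le> (if i \<in> I then p i * q i else 0) + q i / (32 * N) + p i / (32 * N)"
    proof (cases "i \<in> I")
      case True
      then show ?thesis using N p q by simp
    next
      case False
      then consider "p i \<le> 1 / (32 * N)" | "q i \<le> 1 / (32 * N)" using i by (force simp: I_def)
      then have "p i * q i \<le> q i / (32 * N) \<or> p i * q i \<le> p i / (32 * N)"
      proof cases
        case 1
        then show ?thesis using mult_right_mono[OF 1 q(1)[of i]] by simp
      next
        case 2
        then show ?thesis using mult_left_mono[OF 2 p(1)[of i]] by simp
      qed
      moreover have "0 \<le> q i / (32 * N)" "0 \<le> p i / (32 * N)" using N p q by auto
      ultimately show ?thesis using False by auto
    qed
  qed
  also have "\<dots> = (\<Sum>i\<in>I. p i * q i) + (\<Sum>i\<le>n. q i) / (32 * N) + (\<Sum>i\<le>n. p i) / (32 * N)"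
  proof -
    have "(\<Sum>i\<le>n. if i \<in> I then p i * q i else 0) = (\<Sum>i\<in>I. p i * q i)"
      by (subst sum.inter_restrict[symmetric]) (auto simp: I_def intro!: sum.cong)
    then show ?thesis by (simp add: sum.distrib flip: sum_divide_distrib)
  qed
  also have "\<dots> \<le> (\<Sum>i\<in>I. p i * q i) + 1 / (32 * N) + 1 / (32 * N)"
    using p(2) q(2) N by (intro add_mono divide_right_mono) auto
  finally have mass: "1 / (16 * N) \<le> (\<Sum>i\<in>I. p i * q i)" using N by (simp add: field_simps)
  have pos: "0 < p i" "0 < q i" if "i \<in> I" for i
    using that N unfolding I_def by (auto intro: less_le_trans[of 0 "1 / (32 * N)"])
  have "\<forall>i\<in>I. \<exists>a. 1 / 2 ^ (a + 1) < p i \<and> p i \<le> 1 / 2 ^ a"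
    using pos p1 by (intro ballI dyadic_scale) (auto simp: I_def)
  then obtain \<alpha> where \<alpha>: "\<And>i. i \<in> I \<Longrightarrow> 1 / 2 ^ (\<alpha> i + 1) < p i \<and> p i \<le> 1 / 2 ^ \<alpha> i"
    by metis
  have "\<forall>i\<in>I. \<exists>a. 1 / 2 ^ (a + 1) < q i \<and> q i \<le> 1 / 2 ^ a"
    using pos q1 by (intro ballI dyadic_scale) (auto simp: I_def)
  then obtain \<beta> where \<beta>: "\<And>i. i \<in> I \<Longrightarrow> 1 / 2 ^ (\<beta> i + 1) < q i \<and> q i \<le> 1 / 2 ^ \<beta> i"
    by metis
  have le_L: "a \<le> L" if "1 / (32 * N) \<le> t" "t \<le> 1 / 2 ^ a" for t :: real and a
  proof -
    have "1 / (32 * N) \<le> 1 / 2 ^ a" using that by simp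
    then have "2 ^ a \<le> 32 * N" using N by (simp add: field_simps)
    also have "\<dots> \<le> 2 ^ L" using L by (simp add: N_def)
    finally show ?thesis by simp
  qed
  have scales: "(\<alpha> i, \<beta> i) \<in> {..L} \<times> {..L}" if "i \<in> I" for i
    using that \<alpha>[OF that] \<beta>[OF that] le_L by (auto simp: I_def)
  let ?cell = "\<lambda>c. {i \<in> I. (\<alpha> i, \<beta> i) = c}"
  define \<tau> where "\<tau> = 1 / (16 * N) / (real L + 1)\<^sup>2"
  have \<tau>: "0 < \<tau>" using N by (simp add: \<tau>_def)
  have "\<exists>c\<in>{..L} \<times> {..L}. \<tau> \<le> (\<Sum>i\<in>?cell c. p i * q i)"
  proof (rule ccontr)
    assume "\<not> ?thesis"
    then have "(\<Sum>c\<in>{..L} \<times> {..L}. \<Sum>i\<in>?cell c. p i * q i) < (\<Sum>c\<in>{..L} \<times> {..L}. \<tau>)"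
      by (intro sum_strict_mono) (auto simp: not_le simp del: mem_Times_iff)
    also have "\<dots> = (real L + 1)\<^sup>2 * \<tau>"
      by (simp add: card_cartesian_product power2_eq_square algebra_simps)
    also have "\<dots> = 1 / (16 * N)"
    proof -
      have "real L + 1 \<noteq> 0" by linarith
      then show ?thesis by (simp add: \<tau>_def)
    qed
    also have "(\<Sum>c\<in>{..L} \<times> {..L}. \<Sum>i\<in>?cell c. p i * q i) = (\<Sum>i\<in>I. p i * q i)"
      using scales by (intro sum.group[OF finI]) auto
    finally show False using mass by simp
  qed
  then obtain a b where ab: "a \<le> L" "b \<le> L" and cell: "\<tau> \<le> (\<Sum>i\<in>?cell (a, b). p i * q i)"
    by auto
  define Q where "Q = ?cell (a, b)"
  have Q: "Q \<subseteq> {..n}" "finite Q" using finI by (auto simp: Q_def I_def)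
  have pQ: "1 / 2 ^ (a + 1) < p i" "p i \<le> 1 / 2 ^ a" if "i \<in> Q" for i
    using that \<alpha>[of i] by (auto simp: Q_def)
  have qQ: "1 / 2 ^ (b + 1) < q i" "q i \<le> 1 / 2 ^ b" if "i \<in> Q" for i
    using that \<beta>[of i] by (auto simp: Q_def)
  have cellQ: "\<tau> \<le> (\<Sum>i\<in>Q. p i * q i)" using cell by (simp add: Q_def)
  then have "Q \<noteq> {}" using \<tau> by auto
  then have m0: "card Q \<ge> 1" using Q by (simp add: Suc_le_eq card_gt_0_iff)
  obtain s where s: "2 ^ s \<le> card Q" "card Q < 2 ^ (s + 1)"
    using ex_power_ivl1[of 2 "card Q"] m0 by auto
  have sm: "2 ^ s \<le> real (card Q)" "real (card Q) < 2 ^ (s + 1)"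
    using s by (metis of_nat_le_iff of_nat_numeral of_nat_power)
      (metis of_nat_less_iff of_nat_numeral of_nat_power s(2))
  \<comment> \<open>The total mass of \<open>p\<close> bounds the number of its entries exceeding \<open>1 / 2 ^ (a + 1)\<close>;
    this keeps the levels \<open>a + 1 - s\<close> and \<open>b + 1 - s\<close> used below from being truncated at 0.\<close>
  have small: "s \<le> a + 1"
    if "\<And>i. 0 \<le> x i" "(\<Sum>i\<le>n. x i) \<le> 1" "\<And>i. i \<in> Q \<Longrightarrow> 1 / 2 ^ (a + 1) < x i"
    for a and x :: "nat \<Rightarrow> real"
  proof -
    have "real (card Q) * (1 / 2 ^ (a + 1)) \<le> (\<Sum>i\<in>Q. x i)"
      using that(3) by (intro sum_bounded_below) (simp add: less_imp_le)
    also have "\<dots> \<le> (\<Sum>i\<le>n. x i)" using that Q by (intro sum_mono2) auto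
    also have "\<dots> \<le> 1" by fact
    finally have "real (card Q) \<le> 2 ^ (a + 1)" by (simp add: field_simps)
    then have "(2::real) ^ s \<le> 2 ^ (a + 1)" using sm by linarith
    then show ?thesis by (subst (asm) power_increasing_iff) auto
  qed
  have sa: "s \<le> a + 1" using small p pQ by blast
  have sb: "s \<le> b + 1" using small q qQ by blast
  define z where "z = (\<lambda>i. if i \<in> Q then 1 / real (card Q) else 0)"
  have z: "z \<in> simplex_S n"
  proof -
    have "(\<Sum>i\<le>n. z i) = (\<Sum>i\<in>Q. 1 / real (card Q))"
      using Q unfolding z_def by (subst sum.inter_restrict[symmetric]) (auto simp: Int_absorb1)
    then show ?thesis using Q m0 unfolding simplex_S_iff by (auto simp: z_def)
  qed
  have fits: "z i / 2 ^ (a + 1 - s + 2) \<le> x i"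
    if "\<And>i. 0 \<le> x i" "\<And>i. i \<in> Q \<Longrightarrow> 1 / 2 ^ (a + 1) < x i" "s \<le> a + 1"
    for a i and x :: "nat \<Rightarrow> real"
  proof (cases "i \<in> Q")
    case True
    have "z i / 2 ^ (a + 1 - s + 2) = 1 / (real (card Q) * 2 ^ (a + 1 - s + 2))"
      using True by (simp add: z_def)
    also have "\<dots> \<le> 1 / (2 ^ s * 2 ^ (a + 1 - s + 2))"
      using sm m0 by (intro divide_left_mono mult_right_mono mult_pos_pos) auto
    also have "\<dots> = 1 / 2 ^ (a + 3)"
    proof -
      have "s + (a + 1 - s + 2) = a + 3" using that(3) by simp
      then show ?thesis by (simp only: power_add[symmetric])
    qed
    also have "\<dots> \<le> 1 / 2 ^ (a + 1)" by (intro divide_left_mono power_increasing) auto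
    also have "\<dots> \<le> x i" using that(2)[OF True] by simp
    finally show ?thesis .
  qed (use that in \<open>simp add: z_def\<close>)
  have "M - real (a + 1 - s) / 2 - 9 < g z"
  proof (rule coreD[OF cp _ z])
    show "z i / 2 ^ (a + 1 - s + 2) \<le> p i" for i
      using fits[of p a] p(1) pQ(1) sa by blast
  qed (use ab in simp)
  moreover have "M - real (b + 1 - s) / 2 - 9 < - g z"
  proof (rule coreD[OF cq _ z])
    show "z i / 2 ^ (b + 1 - s + 2) \<le> q i" for i
      using fits[of q b] q(1) qQ(1) sb by blast
  qed (use ab in simp)
  moreover have "real (a + 1 - s) = real a + 1 - real s" "real (b + 1 - s) = real b + 1 - real s"
    using sa sb by (simp_all add: of_nat_diff)
  ultimately have "4 * M \<le> 38 + (real a + real b - 2 * real s)" by argo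
  moreover have "real a + real b - real s \<le> log 2 (32 * N * (real L + 1)\<^sup>2)"
  proof -
    have "\<tau> \<le> (\<Sum>i\<in>Q. p i * q i)" by (rule cellQ)
    also have "\<dots> \<le> (\<Sum>i\<in>Q. 1 / 2 ^ a * (1 / 2 ^ b))"
      using pQ qQ p q by (intro sum_mono mult_mono) auto
    also have "\<dots> = real (card Q) / 2 ^ (a + b)" by (simp add: power_add)
    also have "\<dots> \<le> 2 ^ (s + 1) / 2 ^ (a + b)"
      using sm by (intro divide_right_mono) auto
    finally have "\<tau> \<le> 2 ^ (s + 1) / 2 ^ (a + b)" .
    then have "2 ^ (a + b) / 2 ^ s \<le> 32 * N * (real L + 1)\<^sup>2"
      using N by (simp add: \<tau>_def field_simps)
    moreover have "2 powr (real a + real b - real s) = 2 ^ (a + b) / 2 ^ s"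
      by (simp add: powr_diff powr_add powr_realpow power_add)
    ultimately show ?thesis using N by (subst le_log_iff) auto
  qed
  ultimately show ?thesis by (simp add: N_def)
qed

section \<open>Convex hulls of the contact sets\<close>

definition hull_of :: "(nat \<Rightarrow> real) set \<Rightarrow> (nat \<Rightarrow> real) set" where
  "hull_of X = {b. \<exists>F w. finite F \<and> F \<subseteq> X \<and> (\<forall>x\<in>F. 0 \<le> w x) \<and> sum w F = 1 \<and>
     b = (\<lambda>i. \<Sum>x\<in>F. w x * x i)}"

lemma hull_ofI:
  assumes "finite F" "F \<subseteq> X" "\<And>x. x \<in> F \<Longrightarrow> 0 \<le> w x" "sum w F = (1::real)"
    "\<And>i. b i = (\<Sum>x\<in>F. w x * x i)"
  shows "b \<in> hull_of X"
  unfolding hull_of_def using assms by (intro CollectI exI[of _ F] exI[of _ w]) auto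

lemma hull_of_incl:
  assumes "x \<in> X" shows "x \<in> hull_of X"
  using assms by (intro hull_ofI[of "{x}" _ "\<lambda>_. 1"]) auto

lemma hull_of_mix:
  assumes b: "b \<in> hull_of X" and x: "x \<in> X" and t: "0 \<le> t" "t \<le> 1"
  shows "(\<lambda>i. (1 - t) * b i + t * x i) \<in> hull_of X"
proof -
  obtain F w where F: "finite F" "F \<subseteq> X" "\<forall>y\<in>F. 0 \<le> w y" "sum w F = 1"
    and b: "b = (\<lambda>i. \<Sum>y\<in>F. w y * y i)"
    using b unfolding hull_of_def by blast
  define v where "v = (\<lambda>y. (1 - t) * (if y \<in> F then w y else 0) + t * (if y = x then 1 else 0))"
  have *: "(\<Sum>y\<in>insert x F. v y * h y) = (1 - t) * (\<Sum>y\<in>F. w y * h y) + t * h x" for h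
  proof -
    have "(\<Sum>y\<in>insert x F. v y * h y) =
        (\<Sum>y\<in>insert x F. (1 - t) * (if y \<in> F then w y * h y else 0) + (if y = x then t * h x else 0))"
      by (intro sum.cong) (auto simp: v_def algebra_simps)
    also have "\<dots> = (1 - t) * (\<Sum>y\<in>insert x F. if y \<in> F then w y * h y else 0) + t * h x"
      using F(1) by (subst sum.distrib) (simp flip: sum_distrib_left)
    also have "(\<Sum>y\<in>insert x F. if y \<in> F then w y * h y else 0) = (\<Sum>y\<in>F. w y * h y)"
      using F(1) by (subst sum.inter_restrict[symmetric]) (auto intro!: sum.cong)
    finally show ?thesis .
  qed
  show ?thesis
  proof (rule hull_ofI[of "insert x F" _ v])
    show "sum v (insert x F) = 1" using *[of "\<lambda>_. 1"] F(4) by simp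
    show "0 \<le> v y" for y using F t by (auto simp: v_def)
  qed (use F x b * in auto)
qed

lemma hull_of_simplex:
  assumes "b \<in> hull_of X" "X \<subseteq> simplex_S n"
  shows "b \<in> simplex_S n"
proof -
  obtain F w where F: "finite F" "F \<subseteq> X" "\<forall>y\<in>F. 0 \<le> w y" "sum w F = 1"
    and b: "b = (\<lambda>i. \<Sum>y\<in>F. w y * y i)"
    using assms unfolding hull_of_def by blast
  have FS: "y \<in> simplex_S n" if "y \<in> F" for y using that F assms by auto
  have "(\<Sum>i\<le>n. b i) = (\<Sum>y\<in>F. w y * (\<Sum>i\<le>n. y i))"
    unfolding b by (subst sum.swap) (simp add: sum_distrib_left)
  also have "\<dots> = (\<Sum>y\<in>F. w y)"
    using FS by (intro sum.cong) (auto simp: simplex_S_iff)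
  finally have "(\<Sum>i\<le>n. b i) = 1" using F by simp
  moreover have "0 \<le> b i" for i
    unfolding b using F FS by (intro sum_nonneg) (auto simp: simplex_S_iff)
  moreover have "b i = 0" if "i > n" for i
    unfolding b using FS that by (intro sum.neutral) (auto simp: simplex_S_iff)
  ultimately show ?thesis by (auto simp: simplex_S_iff)
qed

text \<open>
  The two averages \<open>B\<close> and \<open>C\<close> of the truncated vectors lie below nearly equal probability vectors
  and miss at most a quarter of the mass each, so their minimum has mass at least
  \<open>1 - 1/4 - 1/4 - 1/8 = 3/8\<close>. By the Cauchy-Schwarz inequality their inner product is at least
  \<open>(3/8)\<^sup>2 / (n + 1)\<close>, and it is an average of the inner products of the pairs.
\<close>

lemma overlapping_truncations:
  assumes b: "b \<in> hull_of X" and c: "c \<in> hull_of Y"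
    and X: "X \<subseteq> simplex_S n" and Y: "Y \<subseteq> simplex_S n"
    and near: "(\<Sum>i\<le>n. \<bar>b i - c i\<bar>) \<le> 1 / 8"
    and S: "\<And>x i. x \<in> X \<Longrightarrow> 0 \<le> S x i \<and> S x i \<le> x i" "\<And>x. x \<in> X \<Longrightarrow> 3 / 4 \<le> (\<Sum>i\<le>n. S x i)"
    and T: "\<And>y i. y \<in> Y \<Longrightarrow> 0 \<le> T y i \<and> T y i \<le> y i" "\<And>y. y \<in> Y \<Longrightarrow> 3 / 4 \<le> (\<Sum>i\<le>n. T y i)"
  shows "\<exists>x\<in>X. \<exists>y\<in>Y. 1 / (8 * (real n + 1)) \<le> (\<Sum>i\<le>n. S x i * T y i)"
proof (rule ccontr)
  assume "\<not> ?thesis"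
  then have less: "(\<Sum>i\<le>n. S x i * T y i) \<le> 1 / (8 * (real n + 1))" if "x \<in> X" "y \<in> Y" for x y
    using that by force
  obtain F w where F: "finite F" "F \<subseteq> X" "\<And>y. y \<in> F \<Longrightarrow> 0 \<le> w y" "sum w F = 1"
    and b': "b = (\<lambda>i. \<Sum>y\<in>F. w y * y i)"
    using b unfolding hull_of_def by blast
  obtain G v where G: "finite G" "G \<subseteq> Y" "\<And>y. y \<in> G \<Longrightarrow> 0 \<le> v y" "sum v G = 1"
    and c': "c = (\<lambda>i. \<Sum>y\<in>G. v y * y i)"
    using c unfolding hull_of_def by blast
  define B where "B = (\<lambda>i. \<Sum>x\<in>F. w x * S x i)"
  define C where "C = (\<lambda>i. \<Sum>y\<in>G. v y * T y i)"
  have B: "0 \<le> B i" "B i \<le> b i" for i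
    unfolding B_def b' using F S by (auto intro!: sum_nonneg sum_mono mult_left_mono)
  have C: "0 \<le> C i" "C i \<le> c i" for i
    unfolding C_def c' using G T by (auto intro!: sum_nonneg sum_mono mult_left_mono)
  have Bmass: "3 / 4 \<le> (\<Sum>i\<le>n. B i)"
  proof -
    have "3 / 4 = (\<Sum>x\<in>F. w x * (3 / 4))" by (subst sum_distrib_right[symmetric]) (simp add: F)
    also have "\<dots> \<le> (\<Sum>x\<in>F. w x * (\<Sum>i\<le>n. S x i))"
      using F S by (intro sum_mono mult_left_mono) auto
    also have "\<dots> = (\<Sum>i\<le>n. B i)"
      unfolding B_def by (subst sum.swap) (simp add: sum_distrib_left)
    finally show ?thesis .
  qed
  have Cmass: "3 / 4 \<le> (\<Sum>i\<le>n. C i)"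
  proof -
    have "3 / 4 = (\<Sum>x\<in>G. v x * (3 / 4))" by (subst sum_distrib_right[symmetric]) (simp add: G)
    also have "\<dots> \<le> (\<Sum>x\<in>G. v x * (\<Sum>i\<le>n. T x i))"
      using G T by (intro sum_mono mult_left_mono) auto
    also have "\<dots> = (\<Sum>i\<le>n. C i)"
      unfolding C_def by (subst sum.swap) (simp add: sum_distrib_left)
    finally show ?thesis .
  qed
  have b1: "(\<Sum>i\<le>n. b i) = 1" and c1: "(\<Sum>i\<le>n. c i) = 1"
    using hull_of_simplex[OF b X] hull_of_simplex[OF c Y] by (auto simp: simplex_S_iff)
  have "3 / 8 \<le> (\<Sum>i\<le>n. B i + C i - c i - \<bar>b i - c i\<bar>)"
    using Bmass Cmass b1 c1 near by (simp add: sum.distrib sum_subtractf)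
  also have "\<dots> \<le> (\<Sum>i\<le>n. min (B i) (C i))"
  proof (rule sum_mono)
    fix i
    show "B i + C i - c i - \<bar>b i - c i\<bar> \<le> min (B i) (C i)"
      using B(2)[of i] C(2)[of i] by linarith
  qed
  finally have "(3 / 8)\<^sup>2 \<le> (\<Sum>i\<le>n. min (B i) (C i))\<^sup>2" by (intro power_mono) auto
  also have "\<dots> \<le> (\<Sum>i\<le>n. (min (B i) (C i))\<^sup>2) * (real n + 1)"
    using sum_squared_le_sum_of_squares[of "\<lambda>i. min (B i) (C i)" "{..n}"] by (simp add: add.commute)
  also have "\<dots> \<le> (\<Sum>i\<le>n. B i * C i) * (real n + 1)"
    unfolding power2_eq_square using B C by (intro mult_right_mono sum_mono mult_mono) auto
  also have "\<dots> \<le> 1 / (8 * (real n + 1)) * (real n + 1)"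
  proof (rule mult_right_mono)
    have "(\<Sum>i\<le>n. B i * C i) = (\<Sum>i\<le>n. \<Sum>x\<in>F. \<Sum>y\<in>G. w x * v y * (S x i * T y i))"
      unfolding B_def C_def sum_product by (simp add: ac_simps)
    also have "\<dots> = (\<Sum>x\<in>F. \<Sum>i\<le>n. \<Sum>y\<in>G. w x * v y * (S x i * T y i))"
      by (rule sum.swap)
    also have "\<dots> = (\<Sum>x\<in>F. \<Sum>y\<in>G. \<Sum>i\<le>n. w x * v y * (S x i * T y i))"
      by (intro sum.cong refl sum.swap)
    also have "\<dots> = (\<Sum>x\<in>F. \<Sum>y\<in>G. w x * v y * (\<Sum>i\<le>n. S x i * T y i))"
      by (simp add: sum_distrib_left)
    also have "\<dots> \<le> (\<Sum>x\<in>F. \<Sum>y\<in>G. w x * v y * (1 / (8 * (real n + 1))))"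
      using F G by (intro sum_mono mult_left_mono less) auto
    also have "\<dots> = sum w F * sum v G * (1 / (8 * (real n + 1)))"
      unfolding sum_product by (simp only: sum_distrib_right)
    finally show "(\<Sum>i\<le>n. B i * C i) \<le> 1 / (8 * (real n + 1))"
      by (simp only: F(4) G(4) mult_1)
  qed simp
  also have "\<dots> = 1 / 8" by simp
  finally show False by (simp add: power2_eq_square)
qed

text \<open>
  A normal vector of a separating hyperplane is the difference of a closest pair of points of the two
  hulls. An almost closest pair also yields a separating direction, with a strip whose width depends
  on \<open>d\<close> alone.
\<close>

lemma separation:
  assumes X: "X \<subseteq> simplex_S n" "X \<noteq> {}" and Y: "Y \<subseteq> simplex_S n" "Y \<noteq> {}"
    and d: "0 < d" and far: "\<And>b c. b \<in> hull_of X \<Longrightarrow> c \<in> hull_of Y \<Longrightarrow> d \<le> (\<Sum>i\<le>n. (b i - c i)\<^sup>2)"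
  shows "\<exists>a. (\<forall>i. \<bar>a i\<bar> \<le> 1) \<and>
    (\<forall>x\<in>X. \<forall>y\<in>Y. (\<Sum>i\<le>n. a i * y i) + d / 2 \<le> (\<Sum>i\<le>n. a i * x i))"
proof -
  define N where "N = real n + 1"
  have N: "1 \<le> N" by (simp add: N_def)
  define D where "D = (\<lambda>(b, c). \<Sum>i\<le>n. (b i - c i :: real)\<^sup>2)"
  let ?P = "hull_of X \<times> hull_of Y"
  \<comment> \<open>The step length towards \<open>(x, y)\<close>: so short that the second-order term \<open>4 * N * t\<^sup>2\<close> of the
    squared distance costs at most \<open>t * d / 2\<close>, which is also the allowed error of the pair.\<close>
  define t where "t = min 1 (d / (8 * N))"
  have t: "0 < t" "t \<le> 1" "t \<le> d / (8 * N)" using d N by (auto simp: t_def)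
  have "4 * N * t \<le> 4 * N * (d / (8 * N))" using t N by (intro mult_left_mono) auto
  also have "\<dots> = d / 2" using N by simp
  finally have tN: "4 * N * t \<le> d / 2" .
  obtain x0 y0 where "x0 \<in> X" "y0 \<in> Y" using X(2) Y(2) by blast
  then have "(x0, y0) \<in> ?P" using hull_of_incl by simp
  then have ne: "D ` ?P \<noteq> {}" by blast
  have bd: "bdd_below (D ` ?P)" using far by (auto simp: D_def intro!: bdd_belowI[of _ d])
  have "Inf (D ` ?P) < Inf (D ` ?P) + t * d / 2" using t d by simp
  then have "\<exists>e\<in>D ` ?P. e < Inf (D ` ?P) + t * d / 2" by (simp only: cInf_less_iff[OF ne bd])
  then obtain b c where b: "b \<in> hull_of X" and c: "c \<in> hull_of Y"
    and near: "D (b, c) < Inf (D ` ?P) + t * d / 2" by blast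
  define a where "a = (\<lambda>i. b i - c i)"
  have bS: "b \<in> simplex_S n" and cS: "c \<in> simplex_S n"
    using hull_of_simplex b c X Y by auto
  have bound: "\<bar>x i - y i\<bar> \<le> 1" if "x \<in> simplex_S n" "y \<in> simplex_S n" for x y i
  proof -
    have "0 \<le> x i" "0 \<le> y i" using that by (auto simp: simplex_S_iff)
    then show ?thesis using simplex_S_le_1[OF that(1), of i] simplex_S_le_1[OF that(2), of i] by linarith
  qed
  have "(\<Sum>i\<le>n. a i * y i) + d / 2 \<le> (\<Sum>i\<le>n. a i * x i)" if x: "x \<in> X" and y: "y \<in> Y" for x y
  proof -
    define v where "v = (\<lambda>i. x i - y i)"
    have vb: "\<bar>v i\<bar> \<le> 1" "\<bar>a i\<bar> \<le> 1" for i
      unfolding v_def a_def using bound x y X Y bS cS by blast+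
    let ?b = "\<lambda>i. (1 - t) * b i + t * x i" and ?c = "\<lambda>i. (1 - t) * c i + t * y i"
    have "?b \<in> hull_of X" "?c \<in> hull_of Y"
      using hull_of_mix b c x y t by auto
    then have "Inf (D ` ?P) \<le> D (?b, ?c)" by (intro cInf_lower[OF _ bd] imageI) auto
    also have "\<dots> = (\<Sum>i\<le>n. (a i)\<^sup>2 + 2 * t * (a i * v i - (a i)\<^sup>2) + t\<^sup>2 * (v i - a i)\<^sup>2)"
      unfolding D_def prod.case a_def v_def
      by (intro sum.cong refl) (simp add: power2_eq_square algebra_simps)
    also have "\<dots> \<le> (\<Sum>i\<le>n. (a i)\<^sup>2 + 2 * t * (a i * v i - (a i)\<^sup>2) + t\<^sup>2 * 4)"
    proof (rule sum_mono)
      fix i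
      have "\<bar>v i - a i\<bar> \<le> 2" using vb[of i] by linarith
      then have "\<bar>v i - a i\<bar>\<^sup>2 \<le> 2\<^sup>2" by (intro power_mono) auto
      then have "t\<^sup>2 * (v i - a i)\<^sup>2 \<le> t\<^sup>2 * 4" by (intro mult_left_mono) auto
      then show "(a i)\<^sup>2 + 2 * t * (a i * v i - (a i)\<^sup>2) + t\<^sup>2 * (v i - a i)\<^sup>2 \<le>
          (a i)\<^sup>2 + 2 * t * (a i * v i - (a i)\<^sup>2) + t\<^sup>2 * 4" by simp
    qed
    also have "\<dots> = D (b, c) + 2 * t * ((\<Sum>i\<le>n. a i * v i) - D (b, c)) + N * (t\<^sup>2 * 4)"
    proof -
      have "D (b, c) = (\<Sum>i\<le>n. (a i)\<^sup>2)" by (simp add: D_def a_def)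
      then show ?thesis
        by (simp add: sum.distrib sum_subtractf N_def flip: sum_distrib_left)
    qed
    also have "N * (t\<^sup>2 * 4) = 4 * N * t * t" by (simp add: power2_eq_square)
    also have "4 * N * t * t \<le> d / 2 * t" using t tN by (intro mult_right_mono) auto
    finally have "0 < 2 * t * ((\<Sum>i\<le>n. a i * v i) - D (b, c)) + t * d / 2 + d / 2 * t"
      using near by linarith
    also have "\<dots> = t * (2 * (\<Sum>i\<le>n. a i * v i) - 2 * D (b, c) + d)" by (simp add: algebra_simps)
    finally have "0 < 2 * (\<Sum>i\<le>n. a i * v i) - 2 * D (b, c) + d"
      using t by (simp add: zero_less_mult_iff)
    moreover have "d \<le> D (b, c)" using far[OF b c] by (simp add: D_def)
    ultimately have "d / 2 \<le> (\<Sum>i\<le>n. a i * v i)" by linarith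
    then show ?thesis by (simp add: v_def right_diff_distrib sum_subtractf)
  qed
  moreover have "\<bar>a i\<bar> \<le> 1" for i unfolding a_def using bound[OF bS cS] .
  ultimately show ?thesis by blast
qed

section \<open>The upper bound for affine approximation\<close>

definition upper_bound :: "nat \<Rightarrow> real" where
  "upper_bound n = (38 + log 2 (32 * (real n + 1) * (log 2 (32 * (real n + 1)) + 2)\<^sup>2)) / 4"

text \<open>
  The number \<open>L\<close> of dyadic scales is of order \<open>log N\<close>, so that it enters the bound for \<open>M\<close> only
  through \<open>log (log N)\<close>.
\<close>

lemma near_contact_bound:
  assumes g: "approx_convex n g" "approx_convex n (\<lambda>x. - g x)"
    and bdd: "\<And>z. z \<in> simplex_S n \<Longrightarrow> \<bar>g z\<bar> \<le> M"
    and b: "b \<in> hull_of {x \<in> simplex_S n. M - 1 \<le> g x}"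
    and c: "c \<in> hull_of {y \<in> simplex_S n. M - 1 \<le> - g y}"
    and near: "(\<Sum>i\<le>n. (b i - c i)\<^sup>2) \<le> 1 / (64 * (real n + 1))"
  shows "M \<le> upper_bound n"
proof -
  define N where "N = real n + 1"
  have N: "1 \<le> N" by (simp add: N_def)
  let ?X = "{x \<in> simplex_S n. M - 1 \<le> g x}" and ?Y = "{y \<in> simplex_S n. M - 1 \<le> - g y}"
  define L where "L = nat \<lceil>log 2 (32 * N)\<rceil>"
  have log0: "0 \<le> log 2 (32 * N)" using N by (subst zero_le_log_cancel_iff) auto
  then have Lle: "real L \<le> log 2 (32 * N) + 1" unfolding L_def by linarith
  have "32 * N = 2 powr log 2 (32 * N)" using N by simp
  also have "\<dots> \<le> 2 powr real L" using log0 unfolding L_def by (intro powr_mono) linarith+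
  finally have L: "32 * N \<le> 2 ^ L" by (simp add: powr_realpow)
  have "(\<Sum>i\<le>n. \<bar>b i - c i\<bar>)\<^sup>2 \<le> (\<Sum>i\<le>n. \<bar>b i - c i\<bar>\<^sup>2) * N"
    using sum_squared_le_sum_of_squares[of "\<lambda>i. \<bar>b i - c i\<bar>" "{..n}"] by (simp add: N_def add.commute)
  also have "\<dots> \<le> 1 / (64 * N) * N" using near N by (intro mult_right_mono) (auto simp: N_def)
  also have "\<dots> = (1 / 8)\<^sup>2" using N by (simp add: power2_eq_square)
  finally have l1: "(\<Sum>i\<le>n. \<bar>b i - c i\<bar>) \<le> 1 / 8" by (rule power2_le_imp_le) simp
  have "\<forall>x\<in>?X. \<exists>p. (\<forall>i. 0 \<le> p i \<and> p i \<le> x i) \<and> 3 / 4 \<le> (\<Sum>i\<le>n. p i) \<and> core n g M (L + 1) p"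
    using core_exists[OF g(1) bdd] by blast
  then obtain S where S: "\<And>x. x \<in> ?X \<Longrightarrow> (\<forall>i. 0 \<le> S x i \<and> S x i \<le> x i) \<and> 3 / 4 \<le> (\<Sum>i\<le>n. S x i) \<and>
      core n g M (L + 1) (S x)"
    by metis
  have "\<forall>y\<in>?Y. \<exists>p. (\<forall>i. 0 \<le> p i \<and> p i \<le> y i) \<and> 3 / 4 \<le> (\<Sum>i\<le>n. p i) \<and>
      core n (\<lambda>x. - g x) M (L + 1) p"
    using core_exists[OF g(2), of M] bdd by auto
  then obtain T where T: "\<And>y. y \<in> ?Y \<Longrightarrow> (\<forall>i. 0 \<le> T y i \<and> T y i \<le> y i) \<and> 3 / 4 \<le> (\<Sum>i\<le>n. T y i) \<and>
      core n (\<lambda>x. - g x) M (L + 1) (T y)"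
    by metis
  have "\<exists>x\<in>?X. \<exists>y\<in>?Y. 1 / (8 * (real n + 1)) \<le> (\<Sum>i\<le>n. S x i * T y i)"
    using S T by (intro overlapping_truncations[OF b c _ _ l1]) blast+
  then obtain x y where x: "x \<in> ?X" and y: "y \<in> ?Y"
    and ov: "1 / (8 * (real n + 1)) \<le> (\<Sum>i\<le>n. S x i * T y i)" by blast
  have Sx: "(\<Sum>i\<le>n. S x i) \<le> 1"
    using S[OF x] x sum_mono[of "{..n}" "S x" x] by (auto simp: simplex_S_iff)
  have Ty: "(\<Sum>i\<le>n. T y i) \<le> 1"
    using T[OF y] y sum_mono[of "{..n}" "T y" y] by (auto simp: simplex_S_iff)
  have "4 * M \<le> 38 + log 2 (32 * (real n + 1) * (real L + 1)\<^sup>2)"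
    using S[OF x] T[OF y] L by (intro overlapping_cores[OF _ Sx _ Ty _ ov]) (auto simp: N_def)
  also have "\<dots> \<le> 38 + log 2 (32 * N * (log 2 (32 * N) + 2)\<^sup>2)"
    unfolding N_def[symmetric] using N Lle
    by (intro add_left_mono log_mono mult_left_mono power_mono mult_pos_pos) auto
  finally show ?thesis by (simp add: upper_bound_def N_def)
qed

lemma affine_fun_midpoint:
  assumes "\<phi> \<in> affine_funs N"
  shows "\<phi> (\<lambda>i. (x i + y i) / 2) = (\<phi> x + \<phi> y) / 2"
  using assms by (auto simp: affine_funs_def add_divide_distrib sum.distrib distrib_left
      simp flip: sum_divide_distrib)

text \<open>
  The improvement adds a small multiple of an affine function that is at least \<open>d / 4\<close> on the upper
  contact set and at most \<open>- d / 4\<close> on the lower one. It is bounded by 3 on the simplex, so the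
  factor \<open>1 / 12\<close> leaves the points outside the contact sets, where there is room 1, out of danger.
  If one contact set is empty, a shift by a constant does. The gain depends only on \<open>d\<close>, so \<open>\<phi>\<close> may
  be chosen close to optimal after \<open>d\<close> is fixed.
\<close>

lemma affine_approximation_improvable:
  assumes \<phi>: "\<phi> \<in> affine_funs (n + 1)" and M: "2 \<le> M" and d: "0 < d" "d \<le> 1"
    and bdd: "\<And>z. z \<in> simplex_S n \<Longrightarrow> \<bar>f z - \<phi> z\<bar> \<le> M"
    and far: "\<And>b c. b \<in> hull_of {x \<in> simplex_S n. M - 1 \<le> f x - \<phi> x} \<Longrightarrow>
      c \<in> hull_of {y \<in> simplex_S n. M - 1 \<le> - (f y - \<phi> y)} \<Longrightarrow> d \<le> (\<Sum>i\<le>n. (b i - c i)\<^sup>2)"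
  shows "\<exists>\<phi>'\<in>affine_funs (n + 1). \<forall>z\<in>simplex_S n. \<bar>f z - \<phi>' z\<bar> \<le> M - d / 48"
proof -
  define g where "g = (\<lambda>x. f x - \<phi> x)"
  have gM: "\<bar>g z\<bar> \<le> M" if "z \<in> simplex_S n" for z using bdd[OF that] by (simp add: g_def)
  define X where "X = {x \<in> simplex_S n. M - 1 \<le> g x}"
  define Y where "Y = {y \<in> simplex_S n. M - 1 \<le> - g y}"
  obtain c0 a0 where \<phi>_eq: "\<phi> = (\<lambda>x. c0 + (\<Sum>i\<le>n. a0 i * x i))"
    using \<phi> by (auto simp: affine_funs_def lessThan_Suc_atMost)
  have *: ?thesis
    if "\<And>z. z \<in> simplex_S n \<Longrightarrow> \<bar>g z - ((\<Sum>i\<le>n. a i * z i) + c)\<bar> \<le> M - d / 48" for a c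
  proof (rule bexI[of _ "\<lambda>x. (c0 + c) + (\<Sum>i\<le>n. (a0 i + a i) * x i)"])
    show "\<forall>z\<in>simplex_S n. \<bar>f z - ((c0 + c) + (\<Sum>i\<le>n. (a0 i + a i) * z i))\<bar> \<le> M - d / 48"
      using that by (simp add: g_def \<phi>_eq sum.distrib distrib_right algebra_simps)
    show "(\<lambda>x. (c0 + c) + (\<Sum>i\<le>n. (a0 i + a i) * x i)) \<in> affine_funs (n + 1)"
      unfolding affine_funs_def Suc_eq_plus1[symmetric] lessThan_Suc_atMost
      by (intro CollectI exI[of _ "c0 + c"] exI[of _ "\<lambda>i. a0 i + a i"] refl)
  qed
  consider "X = {}" | "Y = {}" | "X \<noteq> {}" "Y \<noteq> {}" by blast
  then show ?thesis
  proof cases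
    case 1
    have "\<bar>g z - ((\<Sum>i\<le>n. 0 * z i) + - 1 / 2)\<bar> \<le> M - d / 48" if "z \<in> simplex_S n" for z
    proof -
      have "g z < M - 1" using 1 that by (auto simp: X_def)
      then show ?thesis using gM[OF that] d unfolding mult_zero_left sum.neutral_const by linarith
    qed
    then show ?thesis by (rule *)
  next
    case 2
    have "\<bar>g z - ((\<Sum>i\<le>n. 0 * z i) + 1 / 2)\<bar> \<le> M - d / 48" if "z \<in> simplex_S n" for z
    proof -
      have "- g z < M - 1" using 2 that by (force simp: Y_def)
      then show ?thesis using gM[OF that] d unfolding mult_zero_left sum.neutral_const by linarith
    qed
    then show ?thesis by (rule *)
  next
    case 3
    have "\<exists>a. (\<forall>i. \<bar>a i\<bar> \<le> 1) \<and>
        (\<forall>x\<in>X. \<forall>y\<in>Y. (\<Sum>i\<le>n. a i * y i) + d / 2 \<le> (\<Sum>i\<le>n. a i * x i))"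
      using 3 d far by (intro separation) (auto simp: X_def Y_def g_def)
    then obtain a where a1: "\<And>i. \<bar>a i\<bar> \<le> 1"
      and sep: "\<And>x y. x \<in> X \<Longrightarrow> y \<in> Y \<Longrightarrow> (\<Sum>i\<le>n. a i * y i) + d / 2 \<le> (\<Sum>i\<le>n. a i * x i)"
      by blast
    define l where "l = (\<lambda>x. \<Sum>i\<le>n. a i * x i)"
    have l1: "\<bar>l z\<bar> \<le> 1" if "z \<in> simplex_S n" for z
    proof -
      have "\<bar>l z\<bar> \<le> (\<Sum>i\<le>n. \<bar>a i * z i\<bar>)" unfolding l_def by (rule sum_abs)
      also have "\<dots> \<le> (\<Sum>i\<le>n. z i)"
      proof (rule sum_mono)
        fix i
        have "0 \<le> z i" using that by (simp add: simplex_S_iff)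
        then show "\<bar>a i * z i\<bar> \<le> z i"
          using mult_right_mono[OF a1[of i], of "z i"] by (simp add: abs_mult)
      qed
      finally show ?thesis using that by (simp add: simplex_S_iff)
    qed
    define \<gamma> where "\<gamma> = Sup (l ` Y)"
    have bdl: "bdd_above (l ` Y)"
      using l1 by (intro bdd_aboveI[of _ 1]) (force simp: Y_def abs_le_iff)
    have Y\<gamma>: "l y \<le> \<gamma>" if "y \<in> Y" for y
      unfolding \<gamma>_def using that bdl by (intro cSup_upper) auto
    have X\<gamma>: "\<gamma> \<le> l x - d / 2" if "x \<in> X" for x
      unfolding \<gamma>_def using 3 sep[OF that] by (intro cSup_least) (force simp: l_def)+
    obtain x0 y0 where x0: "x0 \<in> X" and y0: "y0 \<in> Y" using 3 by blast
    have "\<bar>l x0\<bar> \<le> 1" "\<bar>l y0\<bar> \<le> 1" using l1 x0 y0 by (auto simp: X_def Y_def)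
    then have \<gamma>1: "- 1 \<le> \<gamma>" "\<gamma> \<le> 1" using Y\<gamma>[OF y0] X\<gamma>[OF x0] d by linarith+
    have "\<bar>g z - ((\<Sum>i\<le>n. a i / 12 * z i) + - (\<gamma> + d / 4) / 12)\<bar> \<le> M - d / 48"
      if z: "z \<in> simplex_S n" for z
    proof -
      have eq: "(\<Sum>i\<le>n. a i / 12 * z i) = l z / 12"
        by (simp add: l_def sum_divide_distrib)
      consider "z \<in> X" | "z \<in> Y" | "g z < M - 1" "- g z < M - 1"
        using z by (force simp: X_def Y_def)
      then show ?thesis
      proof cases
        case 1
        then have "M - 1 \<le> g z" by (simp add: X_def)
        then show ?thesis using X\<gamma>[OF 1] l1[OF z] \<gamma>1 gM[OF z] M d unfolding eq by (simp add: field_simps abs_le_iff)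
      next
        case 2
        then have "M - 1 \<le> - g z" by (simp add: Y_def)
        then show ?thesis using Y\<gamma>[OF 2] l1[OF z] \<gamma>1 gM[OF z] M d unfolding eq by (simp add: field_simps abs_le_iff)
      next
        case 3
        moreover have "l z / 12 + - (\<gamma> + d / 4) / 12 = l z / 12 - \<gamma> / 12 - d / 48"
          by (simp add: field_simps)
        ultimately show ?thesis
          using l1[OF z] \<gamma>1 M d unfolding eq by linarith
      qed
    qed
    then show ?thesis by (rule *)
  qed
qed

text \<open>
  The contact sets of an affine function with error at most \<open>E + d / 96\<close> must have hulls at squared
  distance at most \<open>d = 1 / (64 * (n + 1))\<close>, since otherwise the improvement by \<open>d / 48\<close> would beat the
  infimum \<open>E\<close>.
\<close>

lemma E2_upper:
  assumes B: "\<And>z. z \<in> simplex_S n \<Longrightarrow> \<bar>f z\<bar> \<le> B"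
    and mid: "\<And>x y. x \<in> simplex_S n \<Longrightarrow> y \<in> simplex_S n \<Longrightarrow>
      \<bar>f x - 2 * f (\<lambda>i. (x i + y i) / 2) + f y\<bar> \<le> 1"
  shows "E2 (n + 1) f (simplex_S n) \<le> ereal (upper_bound n)"
proof (rule ccontr)
  define N where "N = real n + 1"
  have N: "1 \<le> N" by (simp add: N_def)
  assume "\<not> ?thesis"
  then have less: "ereal (upper_bound n) < E2 (n + 1) f (simplex_S n)" by simp
  have upper: "E2 (n + 1) f (simplex_S n) \<le> ereal C"
    if "\<phi> \<in> affine_funs (n + 1)" "\<And>z. z \<in> simplex_S n \<Longrightarrow> \<bar>f z - \<phi> z\<bar> \<le> C" for \<phi> C
    unfolding E2_def using that by (intro INF_lower2[OF that(1)] SUP_least) auto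
  have "(\<lambda>x. 0) \<in> affine_funs (n + 1)"
    unfolding affine_funs_def by (intro CollectI exI[of _ 0] exI[of _ "\<lambda>_. 0"]) simp
  from upper[OF this, of B] have "E2 (n + 1) f (simplex_S n) \<le> ereal B" using B by simp
  then obtain E where E: "E2 (n + 1) f (simplex_S n) = ereal E"
    using less by (cases "E2 (n + 1) f (simplex_S n)") auto
  have UE: "upper_bound n < E" using less E by simp
  have "1 \<le> 32 * N * (log 2 (32 * N) + 2)\<^sup>2"
  proof -
    have "0 \<le> log 2 (32 * N)" using N by (subst zero_le_log_cancel_iff) auto
    then have "1 \<le> (log 2 (32 * N) + 2)\<^sup>2" by (intro one_le_power) auto
    then show ?thesis using N mult_mono[of 1 "32 * N" 1 "(log 2 (32 * N) + 2)\<^sup>2"] by simp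
  qed
  then have "0 \<le> log 2 (32 * N * (log 2 (32 * N) + 2)\<^sup>2)"
    by (subst zero_le_log_cancel_iff) auto
  then have U: "9 \<le> upper_bound n" by (simp add: upper_bound_def N_def)
  define d where "d = 1 / (64 * N)"
  have d: "0 < d" "d \<le> 1" using N by (auto simp: d_def field_simps)
  define M where "M = E + d / 96"
  have "ereal E < ereal M" using d by (simp add: M_def)
  then obtain \<phi> where \<phi>: "\<phi> \<in> affine_funs (n + 1)"
    and "(SUP x\<in>simplex_S n. ereal \<bar>f x - \<phi> x\<bar>) < ereal M"
    unfolding E[symmetric] E2_def INF_less_iff by blast
  then have gM: "\<bar>f z - \<phi> z\<bar> \<le> M" if "z \<in> simplex_S n" for z
    using that by (metis SUP_lessD ereal_less_eq(3) less_imp_le)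
  have g: "approx_convex n (\<lambda>x. f x - \<phi> x)" "approx_convex n (\<lambda>x. - (f x - \<phi> x))"
  proof -
    have *: "2 * f (\<lambda>i. (x i + y i) / 2) \<le> f x + f y + 1" "f x + f y - 1 \<le> 2 * f (\<lambda>i. (x i + y i) / 2)"
      if "x \<in> simplex_S n" "y \<in> simplex_S n" for x y
      using mid[OF that] by linarith+
    show "approx_convex n (\<lambda>x. f x - \<phi> x)" "approx_convex n (\<lambda>x. - (f x - \<phi> x))"
      unfolding approx_convex_def affine_fun_midpoint[OF \<phi>]
      using * by (intro ballI; fastforce simp: field_simps)+
  qed
  show False
  proof (cases "\<exists>b\<in>hull_of {x \<in> simplex_S n. M - 1 \<le> f x - \<phi> x}.
      \<exists>c\<in>hull_of {y \<in> simplex_S n. M - 1 \<le> - (f y - \<phi> y)}. (\<Sum>i\<le>n. (b i - c i)\<^sup>2) \<le> d")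
    case True
    then have "M \<le> upper_bound n"
      using near_contact_bound[OF g gM] unfolding d_def N_def by blast
    then show False using UE d by (simp add: M_def)
  next
    case False
    have "\<exists>\<phi>'\<in>affine_funs (n + 1). \<forall>z\<in>simplex_S n. \<bar>f z - \<phi>' z\<bar> \<le> M - d / 48"
      using False U UE d by (intro affine_approximation_improvable[OF \<phi> _ _ _ gM]) (force simp: M_def)+
    then have "ereal E \<le> ereal (M - d / 48)" using upper E by metis
    then show False using d by (simp add: M_def)
  qed
qed

section \<open>Continuity and second differences on the simplex\<close>

lemma Euclidean_space_top_of_set: "Euclidean_space N = top_of_set {x. \<forall>i\<ge>N. x i = 0}"
  by (simp add: Euclidean_space_def euclidean_product_topology)

lemma C_space_iff:
  assumes "K \<subseteq> topspace (Euclidean_space N)"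
  shows "f \<in> C_space N K \<longleftrightarrow> continuous_on K f"
  using assms
  by (simp add: C_space_def Euclidean_space_top_of_set subtopology_subtopology Int_absorb1)

lemma simplex_S_subset: "simplex_S n \<subseteq> topspace (Euclidean_space (n + 1))"
  by (auto simp: simplex_S_def)

lemma compact_simplex_S: "compact (simplex_S n)"
proof -
  have "compactin (product_topology (\<lambda>i::nat. euclideanreal) UNIV) (PiE UNIV (\<lambda>i. {0..1}))"
    by (simp add: compactin_PiE)
  then have "compact (PiE UNIV (\<lambda>i::nat. {0..1::real}))"
    by (simp add: euclidean_product_topology)
  moreover have "closed (simplex_S n)"
  proof -
    have "simplex_S n = (\<Inter>i. {u. 0 \<le> u i}) \<inter> (\<Inter>i\<in>{n<..}. {u. u i = 0}) \<inter> {u. (\<Sum>i\<le>n. u i) = 1}"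
      by (auto simp: simplex_S_iff)
    then show ?thesis
      by (auto intro!: closed_Int closed_INT closed_Collect_le closed_Collect_eq
          continuous_on_sum continuous_on_const continuous_on_product_coordinates)
  qed
  moreover have "simplex_S n \<subseteq> PiE UNIV (\<lambda>i. {0..1})"
    using simplex_S_le_1 by (auto simp: simplex_S_iff)
  ultimately show ?thesis by (metis compact_Int_closed inf.absorb_iff2)
qed

lemma C_space_bounded:
  assumes "f \<in> C_space (n + 1) (simplex_S n)"
  shows "\<exists>B. \<forall>z\<in>simplex_S n. \<bar>f z\<bar> \<le> B"
proof -
  have "continuous_on (simplex_S n) f" using assms C_space_iff[OF simplex_S_subset] by blast
  then have "bounded (f ` simplex_S n)"
    by (intro compact_imp_bounded compact_continuous_image compact_simplex_S)
  then show ?thesis by (auto simp: bounded_iff)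
qed

lemma omega2_le_1_iff:
  "omega2 (n + 1) f (simplex_S n) \<le> 1 \<longleftrightarrow>
    (\<forall>x\<in>simplex_S n. \<forall>y\<in>simplex_S n. \<bar>f x - 2 * f (\<lambda>i. (x i + y i) / 2) + f y\<bar> \<le> 1)"
    (is "?L \<longleftrightarrow> ?R")
proof
  assume L: ?L
  show ?R
  proof (intro ballI)
    fix x y assume x: "x \<in> simplex_S n" and y: "y \<in> simplex_S n"
    define h where "h = (\<lambda>i. (y i - x i) / 2)"
    have eq: "(\<lambda>i. x i + h i) = (\<lambda>i. (x i + y i) / 2)" "(\<lambda>i. x i + 2 * h i) = y"
      by (auto simp: h_def field_simps)
    have top: "x \<in> topspace (Euclidean_space (n + 1))" "h \<in> topspace (Euclidean_space (n + 1))"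
      using x y by (auto simp: topspace_Euclidean_space simplex_S_iff h_def)
    have "ereal \<bar>f x - 2 * f (\<lambda>i. x i + h i) + f (\<lambda>i. x i + 2 * h i)\<bar> \<le> omega2 (n + 1) f (simplex_S n)"
      unfolding omega2_def
      using top x y simplex_S_midpoint[OF x y] eq by (intro Sup_upper CollectI exI[of _ x] exI[of _ h]) simp
    also have "\<dots> \<le> 1" by fact
    finally show "\<bar>f x - 2 * f (\<lambda>i. (x i + y i) / 2) + f y\<bar> \<le> 1" by (simp add: eq)
  qed
next
  assume R: ?R
  show ?L
    unfolding omega2_def
  proof (rule Sup_least, clarify)
    fix x h :: "nat \<Rightarrow> real"
    assume x: "x \<in> simplex_S n" and y: "(\<lambda>i. x i + 2 * h i) \<in> simplex_S n"
    have "(\<lambda>i. (x i + (x i + 2 * h i)) / 2) = (\<lambda>i. x i + h i)" by (auto simp: field_simps)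
    with R x y have "\<bar>f x - 2 * f (\<lambda>i. x i + h i) + f (\<lambda>i. x i + 2 * h i)\<bar> \<le> 1" by metis
    then show "ereal \<bar>f x - 2 * f (\<lambda>i. x i + h i) + f (\<lambda>i. x i + 2 * h i)\<bar> \<le> 1" by simp
  qed
qed

section \<open>Entropy and the lower bound\<close>

definition half_entropy :: "nat \<Rightarrow> (nat \<Rightarrow> real) \<Rightarrow> real" where
  "half_entropy n u = - (\<Sum>i\<le>n. u i * log 2 (u i)) / 2"

lemma continuous_on_xlogx: "continuous_on {0..} (\<lambda>x::real. x * log 2 x)"
proof -
  have "continuous (at x within {0..}) (\<lambda>x. x * ln x)" if "0 \<le> x" for x :: real
  proof (cases "x = 0")
    case True
    have "((\<lambda>x. x * ln x) \<longlongrightarrow> (0::real)) (at_right 0)" by real_asymp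
    then show ?thesis using True by (simp add: continuous_within at_within_Ici_at_right)
  next
    case False
    then show ?thesis using that by (intro continuous_intros) auto
  qed
  then have "continuous_on {0..} (\<lambda>x::real. x * ln x)"
    by (simp add: continuous_on_eq_continuous_within)
  from continuous_on_mult[OF this continuous_on_const[of _ "1 / ln 2"]] show ?thesis
    by (simp add: log_def)
qed

lemma half_entropy_in_C_space: "half_entropy n \<in> C_space (n + 1) (simplex_S n)"
proof -
  have "continuous_on (simplex_S n) (\<lambda>u. u i * log 2 (u i))" for i
    by (rule continuous_on_compose2[OF continuous_on_xlogx, where f = "\<lambda>u. u i"])
      (auto intro: continuous_on_subset[OF continuous_on_product_coordinates] simp: simplex_S_iff)
  then have "continuous_on (simplex_S n) (\<lambda>u. - (\<Sum>i\<le>n. u i * log 2 (u i)) / 2)"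
    by (intro continuous_on_divide continuous_on_minus continuous_on_sum continuous_on_const) auto
  then show ?thesis
    unfolding C_space_iff[OF simplex_S_subset] half_entropy_def .
qed

text \<open>
  The two bounds are \<open>ln t \<le> t - 1\<close> at \<open>t = s / a\<close> and \<open>t = s / b\<close>, and \<open>a, b \<le> 2 * s\<close>. Summed
  over the coordinates, they say that the Jensen-Shannon divergence lies between 0 and 1 bit.
\<close>

lemma xlogx_midpoint:
  fixes a b :: real
  assumes "0 \<le> a" "0 \<le> b"
  defines "s \<equiv> (a + b) / 2"
  shows "2 * (s * log 2 s) \<le> a * log 2 a + b * log 2 b"
    and "a * log 2 a + b * log 2 b \<le> 2 * (s * log 2 s) + 2 * s"
proof -
  have *: "s - a \<ge> a * ln s - a * ln a" "a * log 2 a \<le> a * (1 + log 2 s)"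
    if a: "0 \<le> a" "a \<le> 2 * s" for a
  proof -
    show "s - a \<ge> a * ln s - a * ln a"
    proof (cases "a = 0")
      case False
      then have "0 < a" "0 < s" using a by auto
      then have "ln (s / a) \<le> s / a - 1" by (intro ln_le_minus_one) simp
      then have "a * ln (s / a) \<le> a * (s / a - 1)" using a by (intro mult_left_mono)
      then show ?thesis using \<open>0 < a\<close> \<open>0 < s\<close> by (simp add: ln_div algebra_simps)
    qed (use a in simp)
    show "a * log 2 a \<le> a * (1 + log 2 s)"
    proof (cases "a = 0")
      case False
      then have "0 < a" "0 < s" using a by auto
      then have "log 2 a \<le> log 2 (2 * s)" using a by simp
      also have "\<dots> = 1 + log 2 s" using \<open>0 < s\<close> by (simp add: log_mult)
      finally show ?thesis using a by (intro mult_left_mono)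
    qed simp
  qed
  have sa: "a \<le> 2 * s" "b \<le> 2 * s" using assms by (auto simp: s_def)
  have ab: "a + b = 2 * s" by (simp add: s_def)
  have "a * ln s + b * ln s \<le> a * ln a + b * ln b"
    using *(1)[OF assms(1) sa(1)] *(1)[OF assms(2) sa(2)] ab by linarith
  then have "(a + b) * ln s \<le> a * ln a + b * ln b" by (simp add: distrib_right)
  then have "(a + b) * ln s / ln 2 \<le> (a * ln a + b * ln b) / ln 2"
    by (intro divide_right_mono) auto
  then show "2 * (s * log 2 s) \<le> a * log 2 a + b * log 2 b"
    unfolding ab by (simp add: log_def add_divide_distrib)
  have "a * log 2 a + b * log 2 b \<le> (a + b) * (1 + log 2 s)"
    using *(2)[OF assms(1) sa(1)] *(2)[OF assms(2) sa(2)] by (simp add: distrib_right)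
  then show "a * log 2 a + b * log 2 b \<le> 2 * (s * log 2 s) + 2 * s"
    unfolding ab by (simp add: algebra_simps)
qed

lemma half_entropy_omega2: "omega2 (n + 1) (half_entropy n) (simplex_S n) \<le> 1"
  unfolding omega2_le_1_iff
proof (intro ballI)
  fix x y assume x: "x \<in> simplex_S n" and y: "y \<in> simplex_S n"
  let ?h = "\<lambda>t::real. t * log 2 t" and ?m = "\<lambda>i. (x i + y i) / 2"
  have nonneg: "0 \<le> x i" "0 \<le> y i" for i using x y by (auto simp: simplex_S_iff)
  have "(\<Sum>i\<le>n. 2 * ?h (?m i)) \<le> (\<Sum>i\<le>n. ?h (x i) + ?h (y i))"
    using xlogx_midpoint(1) nonneg by (intro sum_mono) blast
  moreover have "(\<Sum>i\<le>n. ?h (x i) + ?h (y i)) \<le> (\<Sum>i\<le>n. 2 * ?h (?m i) + 2 * ?m i)"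
    using xlogx_midpoint(2) nonneg by (intro sum_mono) blast
  moreover have "(\<Sum>i\<le>n. 2 * ?m i) = 2"
  proof -
    have "(\<Sum>i\<le>n. 2 * ?m i) = (\<Sum>i\<le>n. x i + y i)" by (intro sum.cong) auto
    then show ?thesis using x y by (simp add: simplex_S_iff sum.distrib)
  qed
  ultimately have "2 * (\<Sum>i\<le>n. ?h (?m i)) \<le> (\<Sum>i\<le>n. ?h (x i)) + (\<Sum>i\<le>n. ?h (y i))"
    "(\<Sum>i\<le>n. ?h (x i)) + (\<Sum>i\<le>n. ?h (y i)) \<le> 2 * (\<Sum>i\<le>n. ?h (?m i)) + 2"
    by (simp_all only: sum.distrib sum_distrib_left)
  then show "\<bar>half_entropy n x - 2 * half_entropy n ?m + half_entropy n y\<bar> \<le> 1"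
    unfolding half_entropy_def by linarith
qed

text \<open>
  If an affine \<open>\<phi>\<close> were closer than \<open>log 2 N / 4\<close>, it would be less than that at the vertices, hence at
  the barycentre, where the function equals \<open>log 2 N / 2\<close>.
\<close>

lemma half_entropy_E2: "ereal (log 2 (real n + 1) / 4) \<le> E2 (n + 1) (half_entropy n) (simplex_S n)"
  unfolding E2_def
proof (rule INF_greatest)
  fix \<phi> assume "\<phi> \<in> affine_funs (n + 1)"
  then obtain c a where \<phi>: "\<phi> = (\<lambda>x. c + (\<Sum>i\<le>n. a i * x i))"
    by (auto simp: affine_funs_def lessThan_Suc_atMost)
  define N where "N = real n + 1"
  have N: "1 \<le> N" by (simp add: N_def)
  have "real (card {..n}) = N" by (simp add: N_def)
  then have avg: "(\<Sum>j\<le>n. k / N) = k" for k using N by (simp only: sum_constant) simp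
  show "ereal (log 2 (real n + 1) / 4) \<le> (SUP x\<in>simplex_S n. ereal \<bar>half_entropy n x - \<phi> x\<bar>)"
  proof (rule ccontr)
    assume "\<not> ?thesis"
    then have sup: "(SUP x\<in>simplex_S n. ereal \<bar>half_entropy n x - \<phi> x\<bar>) < ereal (log 2 N / 4)"
      by (simp add: N_def not_le)
    have less: "\<bar>half_entropy n x - \<phi> x\<bar> < log 2 N / 4" if "x \<in> simplex_S n" for x
      using SUP_lessD[OF sup that] by (simp only: less_ereal.simps)
    have vertex: "c + a i \<le> log 2 N / 4" if "i \<le> n" for i
    proof -
      let ?e = "\<lambda>j. if j = i then 1 else 0 :: real"
      have "?e \<in> simplex_S n" using that by (auto simp: simplex_S_iff)
      moreover have "half_entropy n ?e = 0"
        unfolding half_entropy_def by (auto intro!: sum.neutral)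
      moreover have "\<phi> ?e = c + a i"
      proof -
        have "(\<Sum>j\<le>n. a j * ?e j) = (\<Sum>j\<le>n. if j = i then a j else 0)"
          by (intro sum.cong) auto
        then show ?thesis using that by (simp add: \<phi>)
      qed
      ultimately have "\<bar>0 - (c + a i)\<bar> < log 2 N / 4" using less[of ?e] by (simp only:)
      then show ?thesis by linarith
    qed
    let ?z = "\<lambda>j. if j \<le> n then 1 / N else 0 :: real"
    have "(\<Sum>j\<le>n. ?z j) = (\<Sum>j\<le>n. 1 / N)" by (intro sum.cong) auto
    also have "\<dots> = 1" by (rule avg)
    finally have "?z \<in> simplex_S n" using N by (auto simp: simplex_S_iff)
    then have "\<bar>half_entropy n ?z - \<phi> ?z\<bar> < log 2 N / 4" by (rule less)
    moreover have "half_entropy n ?z = log 2 N / 2"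
    proof -
      have "(\<Sum>j\<le>n. ?z j * log 2 (?z j)) = (\<Sum>j\<le>n. - log 2 N / N)"
        using N by (intro sum.cong) (auto simp: log_divide)
      also have "\<dots> = - log 2 N" by (rule avg)
      finally show ?thesis by (simp add: half_entropy_def)
    qed
    moreover have "\<phi> ?z \<le> log 2 N / 4"
    proof -
      have "\<phi> ?z = c + (\<Sum>j\<le>n. a j / N)" unfolding \<phi> by (intro arg_cong2[of _ _ _ _ "(+)"] sum.cong) auto
      also have "\<dots> = (\<Sum>j\<le>n. c / N) + (\<Sum>j\<le>n. a j / N)" by (simp only: avg)
      also have "\<dots> = (\<Sum>j\<le>n. (c + a j) / N)"
        by (simp add: sum.distrib add_divide_distrib)
      also have "\<dots> \<le> (\<Sum>j\<le>n. log 2 N / 4 / N)"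
        using vertex N by (intro sum_mono divide_right_mono) auto
      also have "\<dots> = log 2 N / 4" by (rule avg)
      finally show ?thesis .
    qed
    ultimately show False by linarith
  qed
qed

section \<open>The limit\<close>

lemma w2_simplex_lower: "ereal (log 2 (real n + 1) / 4) \<le> w2 (n + 1) (simplex_S n)"
proof -
  have "E2 (n + 1) (half_entropy n) (simplex_S n) \<le> w2 (n + 1) (simplex_S n)"
    unfolding w2_def using half_entropy_in_C_space half_entropy_omega2 by (intro Sup_upper) blast
  with half_entropy_E2 show ?thesis by (rule order_trans)
qed

lemma w2_simplex_upper: "w2 (n + 1) (simplex_S n) \<le> ereal (upper_bound n)"
  unfolding w2_def
proof (rule Sup_least, clarify)
  fix f assume f: "f \<in> C_space (n + 1) (simplex_S n)" and om: "omega2 (n + 1) f (simplex_S n) \<le> 1"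
  obtain B where "\<And>z. z \<in> simplex_S n \<Longrightarrow> \<bar>f z\<bar> \<le> B" using C_space_bounded[OF f] by blast
  then show "E2 (n + 1) f (simplex_S n) \<le> ereal (upper_bound n)"
    using om unfolding omega2_le_1_iff by (intro E2_upper) blast+
qed

theorem theorem3p6:
  shows "((\<lambda>n. w2 (n + 1) (simplex_S n) / ereal (log 2 (real n))) \<longlongrightarrow> ereal (1 / 4)) sequentially"
proof (rule tendsto_sandwich)
  have pos: "0 < ereal (log 2 (real n))" and nz: "log 2 (real n) \<noteq> 0" if "2 \<le> n" for n
  proof -
    have "0 < log 2 (real n)" using that by simp
    then show "0 < ereal (log 2 (real n))" "log 2 (real n) \<noteq> 0" by (simp, metis less_irrefl)
  qed
  show "\<forall>\<^sub>F n in sequentially. ereal (log 2 (real n + 1) / 4 / log 2 (real n)) \<le>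
      w2 (n + 1) (simplex_S n) / ereal (log 2 (real n))"
    using eventually_ge_at_top[of 2]
  proof eventually_elim
    case (elim n)
    have "ereal (log 2 (real n + 1) / 4) / ereal (log 2 (real n)) \<le>
        w2 (n + 1) (simplex_S n) / ereal (log 2 (real n))"
      using w2_simplex_lower pos[OF elim] by (rule ereal_divide_right_mono)
    then show ?case using nz[OF elim] by (simp only: ereal_divide if_False)
  qed
  show "\<forall>\<^sub>F n in sequentially. w2 (n + 1) (simplex_S n) / ereal (log 2 (real n)) \<le>
      ereal (upper_bound n / log 2 (real n))"
    using eventually_ge_at_top[of 2]
  proof eventually_elim
    case (elim n)
    have "w2 (n + 1) (simplex_S n) / ereal (log 2 (real n)) \<le>
        ereal (upper_bound n) / ereal (log 2 (real n))"
      using w2_simplex_upper pos[OF elim] by (rule ereal_divide_right_mono)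
    then show ?case using nz[OF elim] by (simp only: ereal_divide if_False)
  qed
  have "(\<lambda>n. log 2 (real n + 1) / 4 / log 2 (real n)) \<longlonglongrightarrow> 1 / 4" by real_asymp
  then show "(\<lambda>n. ereal (log 2 (real n + 1) / 4 / log 2 (real n))) \<longlonglongrightarrow> ereal (1 / 4)"
    by (rule tendsto_ereal)
  have "(\<lambda>n. upper_bound n / log 2 (real n)) \<longlonglongrightarrow> 1 / 4"
    unfolding upper_bound_def by real_asymp
  then show "(\<lambda>n. ereal (upper_bound n / log 2 (real n))) \<longlonglongrightarrow> ereal (1 / 4)"
    by (rule tendsto_ereal)
qed

end
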